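(* Let $\mathbb{K}\in\{\mathbb{R},\mathbb{C}\}$ and let $\mathfrak{r}=\mathfrak{n}\oplus\mathfrak{t}$ be a solvable non-nilpotent Lie algebra over $\mathbb{K}$, with nilradical $\mathfrak{n}$ and $\mathfrak{t}$ a torus of derivations. Let $\{X_1,\dots,X_n,V_1,\dots,V_p\}$ be a basis of $\mathfrak{r}$ such that $X_1,\dots,X_n$ span $\mathfrak{n}$ and $V_1,\dots,V_p$ span $\mathfrak{t}$, with corresponding coordinates $x_1,\dots,x_n,v_1,\dots,v_p$ on $\mathfrak{r}^*$. Suppose that every invariant $F$ of the coadjoint representation of $\mathfrak{r}$ satisfies $\partial F/\partial v_i=0$ for $1\le i\le p$. Let $\mathfrak{t}'$ be a one-dimensional subtorus (subalgebra) of $\mathfrak{t}$ whose action on the center $Z(\mathfrak{n})$ of the nilradical is nonzero, i.e. $[\mathfrak{t}',Z(\mathfrak{n})]\neq 0$, and let $\mathfrak{r}'=\mathfrak{n}\oplus\mathfrak{t}'\subset\mathfrak{r}$. Then every element $F$ of a fundamental set of invariants for $\mathfrak{r}$ (regarded as a function of $x_1,\dots,x_n$ only) is an invariant of $\mathfrak{r}'$. Moreover, $\mathcal{N}(\mathfrak{r}')\ge\mathcal{N}(\mathfrak{r})$.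
   Context: Lie algebras are finite-dimensional. The decomposition $\mathfrak{r}=\mathfrak{n}\oplus\mathfrak{t}$ is a direct sum of vector spaces (semidirect product), where $\mathfrak{t}$ is an abelian subalgebra consisting of $\mathrm{ad}$-semisimple elements (an exterior torus of derivations). Invariants: let $\mathfrak{g}$ be a Lie algebra over $\mathbb{K}$ with basis $Z_1,\dots,Z_d$, $[Z_i,Z_j]=\sum_k C_{ij}^kZ_k$, and let $z_1,\dots,z_d$ be the corresponding linear coordinates on $\mathfrak{g}^*$. An invariant of the coadjoint representation (generalized Casimir invariant) is a differentiable function $F$ (smooth if $\mathbb{K}=\mathbb{R}$, holomorphic if $\mathbb{K}=\mathbb{C}$), considered locally on a nonempty open subset of $\mathfrak{g}^*$ (which may be shrunk), with $\widehat{Z_i}F:=-\sum_{j,k}C_{ij}^kz_k\,\partial F/\partial z_j=0$ for all $i$. A fundamental set of invariants is a maximal set of functionally independent invariants. $\mathcal{N}(\mathfrak{g})$ denotes the number of functionally independent invariants; by the Beltrametti–Blasi formula, $\mathcal{N}(\mathfrak{g})=\dim\mathfrak{g}-r(\mathfrak{g})$, where $r(\mathfrak{g})$ is the maximal rank of the commutator matrix $\left(\sum_k C_{ij}^kz_k\right)_{1\le i,j\le d}$ over all points $z\in\mathfrak{g}^*$. *)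

theory Defs
  imports "HOL-Analysis.Analysis"
begin

section \<open>The ground field\<close>

text \<open>A single type variable of this class covers both ground fields: up to isomorphism its only
  members are the reals (first alternative) and the complex numbers (second alternative).\<close>

class real_or_complex = real_normed_field +
  assumes real_or_complex:
    "(\<forall>z. \<exists>a. z = a *\<^sub>R 1) \<or>
     (\<exists>\<iota>. \<iota> * \<iota> = - 1 \<and> (\<forall>z. \<exists>a b. z = a *\<^sub>R 1 + b *\<^sub>R \<iota>))"

instance real :: real_or_complex
  by standard auto

instance complex :: real_or_complex
proof
  have "\<i> * \<i> = - 1 \<and> (\<forall>z. \<exists>a b. z = a *\<^sub>R 1 + b *\<^sub>R \<i>)"
    by (auto simp: complex_eq_iff)
  then show "(\<forall>z::complex. \<exists>a. z = a *\<^sub>R 1) \<or>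
     (\<exists>\<iota>::complex. \<iota> * \<iota> = - 1 \<and> (\<forall>z. \<exists>a b. z = a *\<^sub>R 1 + b *\<^sub>R \<iota>))"
    by blast
qed


section \<open>Lie algebras\<close>

locale lie_algebra = vector_space scale
  for scale :: "'k::real_or_complex \<Rightarrow> 'a::ab_group_add \<Rightarrow> 'a" +
  fixes bracket :: "'a \<Rightarrow> 'a \<Rightarrow> 'a"
  assumes linear_right: "Vector_Spaces.linear scale scale (\<lambda>y. bracket x y)"
    and linear_left: "Vector_Spaces.linear scale scale (\<lambda>x. bracket x y)"
    and alternating: "bracket x x = 0"
    and jacobi: "bracket x (bracket y z) + bracket y (bracket z x) + bracket z (bracket x y) = 0"
begin

definition bracket_span :: "'a set \<Rightarrow> 'a set \<Rightarrow> 'a set" where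
  "bracket_span A B = span {bracket x y | x y. x \<in> A \<and> y \<in> B}"

definition subalgebra :: "'a set \<Rightarrow> bool" where
  "subalgebra S \<longleftrightarrow> subspace S \<and> (\<forall>x\<in>S. \<forall>y\<in>S. bracket x y \<in> S)"

definition ideal :: "'a set \<Rightarrow> bool" where
  "ideal I \<longleftrightarrow> subspace I \<and> (\<forall>x. \<forall>y\<in>I. bracket x y \<in> I)"

definition abelian :: "'a set \<Rightarrow> bool" where
  "abelian S \<longleftrightarrow> (\<forall>x\<in>S. \<forall>y\<in>S. bracket x y = 0)"

definition center :: "'a set \<Rightarrow> 'a set" where
  "center S = {x \<in> S. \<forall>y\<in>S. bracket x y = 0}"

primrec derived_series :: "'a set \<Rightarrow> nat \<Rightarrow> 'a set" where
  "derived_series S 0 = S"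
| "derived_series S (Suc k) = bracket_span (derived_series S k) (derived_series S k)"

primrec lower_central_series :: "'a set \<Rightarrow> nat \<Rightarrow> 'a set" where
  "lower_central_series S 0 = S"
| "lower_central_series S (Suc k) = bracket_span S (lower_central_series S k)"

definition solvable :: "'a set \<Rightarrow> bool" where
  "solvable S \<longleftrightarrow> (\<exists>k. derived_series S k = {0})"

definition nilpotent :: "'a set \<Rightarrow> bool" where
  "nilpotent S \<longleftrightarrow> (\<exists>k. lower_central_series S k = {0})"

definition is_nilradical :: "'a set \<Rightarrow> bool" where
  "is_nilradical N \<longleftrightarrow>
     ideal N \<and> nilpotent N \<and> (\<forall>I. ideal I \<and> nilpotent I \<longrightarrow> I \<subseteq> N)"

definition is_direct_sum :: "'a set \<Rightarrow> 'a set \<Rightarrow> 'a set \<Rightarrow> bool" where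
  "is_direct_sum S A B \<longleftrightarrow>
     subspace A \<and> subspace B \<and> A \<inter> B = {0} \<and> S = {a + b | a b. a \<in> A \<and> b \<in> B}"

text \<open>Semisimplicity is complete reducibility, so over the reals it means diagonalisability
  over the complex numbers.\<close>

definition semisimple_endo :: "('a \<Rightarrow> 'a) \<Rightarrow> bool" where
  "semisimple_endo f \<longleftrightarrow> Vector_Spaces.linear scale scale f \<and>
     (\<forall>W. subspace W \<and> f ` W \<subseteq> W \<longrightarrow> (\<exists>W'. f ` W' \<subseteq> W' \<and> is_direct_sum UNIV W W'))"

definition torus :: "'a set \<Rightarrow> bool" where
  "torus T \<longleftrightarrow> subalgebra T \<and> abelian T \<and> (\<forall>x\<in>T. semisimple_endo (bracket x))"

definition is_basis :: "('m \<Rightarrow> 'a) \<Rightarrow> 'a set \<Rightarrow> bool" where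
  "is_basis Z S \<longleftrightarrow> inj Z \<and> independent (range Z) \<and> span (range Z) = S"

definition structure_constant :: "('m \<Rightarrow> 'a) \<Rightarrow> 'm \<Rightarrow> 'm \<Rightarrow> 'm \<Rightarrow> 'k" where
  "structure_constant Z i j k = representation (range Z) (bracket (Z i) (Z j)) (Z k)"

end


section \<open>Differentiable functions of several variables\<close>

definition pderiv_at :: "'m::finite \<Rightarrow> ('k::real_normed_field ^ 'm \<Rightarrow> 'k) \<Rightarrow> 'k ^ 'm \<Rightarrow> 'k" where
  "pderiv_at j F z = deriv (\<lambda>t. F (z + axis j t)) 0"

text \<open>All iterated partial derivatives exist and are continuous.\<close>

definition smooth_on :: "('k::real_normed_field ^ 'm::finite) set \<Rightarrow> ('k ^ 'm \<Rightarrow> 'k) \<Rightarrow> bool" where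
  "smooth_on U F \<longleftrightarrow>
     (\<forall>js. continuous_on U (foldr pderiv_at js F) \<and>
       (\<forall>z\<in>U. \<forall>j. (\<lambda>t. foldr pderiv_at js F (z + axis j t)) field_differentiable (at 0)))"

text \<open>Frechet differentiability with a derivative that is linear over the ground field.\<close>

definition holomorphic_fun_on ::
    "('k::real_normed_field ^ 'm::finite) set \<Rightarrow> ('k ^ 'm \<Rightarrow> 'k) \<Rightarrow> bool" where
  "holomorphic_fun_on U F \<longleftrightarrow>
     (\<forall>z\<in>U. \<exists>D. (F has_derivative D) (at z) \<and> (\<forall>c v. D (c *s v) = c * D v))"

text \<open>The test \<open>UNIV = \<real>\<close> singles out the real ground field.\<close>

definition differentiable_fun_on ::
    "('k::real_or_complex ^ 'm::finite) set \<Rightarrow> ('k ^ 'm \<Rightarrow> 'k) \<Rightarrow> bool" where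
  "differentiable_fun_on U F \<longleftrightarrow>
     (if (UNIV :: 'k set) = \<real> then smooth_on U F else holomorphic_fun_on U F)"

lemma differentiable_fun_on_real:
  fixes F :: "real ^ 'm::finite \<Rightarrow> real"
  shows "differentiable_fun_on U F \<longleftrightarrow> smooth_on U F"
  by (simp add: differentiable_fun_on_def Reals_def)

lemma differentiable_fun_on_complex:
  fixes F :: "complex ^ 'm::finite \<Rightarrow> complex"
  shows "differentiable_fun_on U F \<longleftrightarrow> holomorphic_fun_on U F"
proof -
  have "(UNIV :: complex set) \<noteq> \<real>"
    using complex_is_Real_iff[of \<i>] by (metis UNIV_I imaginary_unit.sel(2) zero_neq_one)
  then show ?thesis
    by (simp add: differentiable_fun_on_def)
qed

text \<open>Generic rank: the Jacobian has full rank at the points of a dense subset of \<open>U\<close>.\<close>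

definition functionally_independent_on ::
    "('k::real_normed_field ^ 'm::finite) set \<Rightarrow> nat \<Rightarrow> (nat \<Rightarrow> 'k ^ 'm \<Rightarrow> 'k) \<Rightarrow> bool" where
  "functionally_independent_on U q F \<longleftrightarrow>
     U \<subseteq> closure {z \<in> U. \<forall>c. (\<forall>j. (\<Sum>i<q. c i * pderiv_at j (F i) z) = 0) \<longrightarrow> (\<forall>i<q. c i = 0)}"


section \<open>Invariants of the coadjoint representation\<close>

text \<open>The family \<open>Z\<close> is a basis of the Lie algebra \<open>\<gg>\<close> under consideration (possibly a proper
  subalgebra of the ambient one). A point of the dual of \<open>\<gg>\<close> is represented by the vector of its
  values on \<open>Z\<close>, that is, by its coordinates with respect to the dual basis.\<close>

context lie_algebra
begin

definition coadjoint_field ::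
    "('m::finite \<Rightarrow> 'a) \<Rightarrow> 'm \<Rightarrow> ('k ^ 'm \<Rightarrow> 'k) \<Rightarrow> 'k ^ 'm \<Rightarrow> 'k" where
  "coadjoint_field Z i F z =
     - (\<Sum>j\<in>UNIV. \<Sum>k\<in>UNIV. structure_constant Z i j k * z $ k * pderiv_at j F z)"

definition invariant_on ::
    "('m::finite \<Rightarrow> 'a) \<Rightarrow> ('k ^ 'm) set \<Rightarrow> ('k ^ 'm \<Rightarrow> 'k) \<Rightarrow> bool" where
  "invariant_on Z U F \<longleftrightarrow>
     open U \<and> U \<noteq> {} \<and> differentiable_fun_on U F \<and> (\<forall>z\<in>U. \<forall>i. coadjoint_field Z i F z = 0)"

definition independent_invariants_on ::
    "('m::finite \<Rightarrow> 'a) \<Rightarrow> ('k ^ 'm) set \<Rightarrow> nat \<Rightarrow> (nat \<Rightarrow> 'k ^ 'm \<Rightarrow> 'k) \<Rightarrow> bool" where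
  "independent_invariants_on Z U q F \<longleftrightarrow>
     open U \<and> U \<noteq> {} \<and> (\<forall>i<q. invariant_on Z U (F i)) \<and> functionally_independent_on U q F"

text \<open>Maximality is local: no further independent invariant exists on any smaller open set.\<close>

definition fundamental_invariants_on ::
    "('m::finite \<Rightarrow> 'a) \<Rightarrow> ('k ^ 'm) set \<Rightarrow> nat \<Rightarrow> (nat \<Rightarrow> 'k ^ 'm \<Rightarrow> 'k) \<Rightarrow> bool" where
  "fundamental_invariants_on Z U q F \<longleftrightarrow>
     independent_invariants_on Z U q F \<and>
     (\<forall>U' G. U' \<subseteq> U \<longrightarrow> \<not> independent_invariants_on Z U' (Suc q) (F(q := G)))"

text \<open>The maximum is over a set containing \<open>0\<close> and bounded by \<open>CARD('m)\<close>.\<close>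

definition number_of_invariants :: "('m::finite \<Rightarrow> 'a) \<Rightarrow> nat" where
  "number_of_invariants Z = Max {q. \<exists>U F. independent_invariants_on Z U q F}"

end

text \<open>The coordinates indexed by the left summand; for the duals of \<open>\<nn> \<oplus> \<tt>\<close> and \<open>\<nn> \<oplus> \<tt>'\<close>
  these are the coordinates on the dual of \<open>\<nn>\<close>.\<close>

definition left_coords :: "'k ^ ('n::finite + 'p::finite) \<Rightarrow> 'k ^ 'n" where
  "left_coords z = (\<chi> i. z $ Inl i)"

end

theory Submission
  imports Defs
begin

text \<open>An invariant of \<open>\<rr>\<close> whose derivatives along \<open>\<tt>\<close> vanish is, on a box, a function of the
  coordinates on the dual of \<open>\<nn>\<close> alone. On such functions the coadjoint field of an element \<open>y\<close>
  involves only the brackets of \<open>y\<close> with \<open>\<nn>\<close>, which lie in the ideal \<open>\<nn>\<close>, and depends linearly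
  on \<open>y\<close>. Hence annihilation by the fields of a basis of \<open>\<rr>\<close> gives annihilation by those of
  \<open>\<nn> \<oplus> \<tt>'\<close>. The Jacobian does not change either, so independent invariants of \<open>\<rr>\<close> yield
  equally many independent invariants of \<open>\<nn> \<oplus> \<tt>'\<close>.\<close>

section \<open>Functions of the left coordinates\<close>

text \<open>Closeness is imposed coordinate by coordinate, so that single coordinates can be moved
  to those of the centre without leaving the set.\<close>

definition coord_box :: "'k::metric_space ^ 'm::finite \<Rightarrow> real \<Rightarrow> ('k ^ 'm) set" where
  "coord_box z e = {w. \<forall>i. dist (w $ i) (z $ i) < e}"

text \<open>Applied to \<open>left_coords w\<close>, where \<open>w\<close> may carry a different
  block of right coordinates, this is the substitution that transports functions from one dual to
  another: the right coordinates are frozen at those of \<open>z\<close>.\<close>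

definition replace_left ::
    "'k ^ ('n::finite + 'p::finite) \<Rightarrow> 'k ^ 'n \<Rightarrow> 'k ^ ('n + 'p)" where
  "replace_left z x = (\<chi> i. case i of Inl a \<Rightarrow> x $ a | Inr b \<Rightarrow> z $ Inr b)"

lemma replace_left_nth [simp]:
  "replace_left z x $ Inl a = x $ a"
  "replace_left z x $ Inr b = z $ Inr b"
  by (simp_all add: replace_left_def)

lemma left_coords_nth [simp]: "left_coords z $ a = z $ Inl a"
  by (simp add: left_coords_def)

lemma left_coords_replace_left [simp]: "left_coords (replace_left z x) = x"
  by (simp add: vec_eq_iff)

lemma vec_sum_eq_iff:
  "v = w \<longleftrightarrow> (\<forall>a. v $ Inl a = w $ Inl a) \<and> (\<forall>b. v $ Inr b = w $ Inr b)"
  unfolding vec_eq_iff by (metis obj_sumE)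

lemma axis_sum_nth [simp]:
  "axis (Inl a) t $ Inl a' = axis a t $ a'"
  "axis (Inl a) t $ Inr b = 0"
  "axis (Inr b) t $ Inl a = 0"
  "axis (Inr b) t $ Inr b' = axis b t $ b'"
  by (auto simp: axis_def)

lemma replace_left_add_axis_Inl:
  fixes z :: "'k::real_normed_field ^ ('n::finite + 'p::finite)"
  shows "replace_left z (left_coords (w + axis (Inl a) t)) =
   replace_left z (left_coords w) + axis (Inl a) t"
  by (auto simp: vec_sum_eq_iff axis_def)

lemma replace_left_add_axis_Inr:
  fixes z :: "'k::real_normed_field ^ ('n::finite + 'p::finite)"
  shows "replace_left z (left_coords (w + axis (Inr b) t)) = replace_left z (left_coords w)"
  by (auto simp: vec_sum_eq_iff axis_def)

section \<open>Coordinate boxes and the cylinders over them\<close>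

lemma open_coord_box: "open (coord_box z e)"
proof -
  have "coord_box z e = (\<Inter>i. {w. dist (w $ i) (z $ i) < e})"
    by (auto simp: coord_box_def)
  then show ?thesis
    by (auto intro!: open_INT open_Collect_less continuous_intros)
qed

lemma centre_in_coord_box: "e > 0 \<Longrightarrow> z \<in> coord_box z e"
  by (simp add: coord_box_def)

lemma coord_box_subset:
  fixes U :: "('k::real_normed_field ^ 'm::finite) set"
  assumes "open U" "z \<in> U"
  obtains e where "e > 0" "coord_box z e \<subseteq> U"
proof -
  obtain A where A: "\<And>i. open (A i)" "\<And>i. z $ i \<in> A i"
      and sub: "\<And>y. (\<forall>i. y $ i \<in> A i) \<Longrightarrow> y \<in> U"
    using assms unfolding open_vec_def by metis
  have "\<forall>i. \<exists>d>0. \<forall>y. dist y (z $ i) < d \<longrightarrow> y \<in> A i"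
    using A unfolding open_dist by blast
  then obtain d where d: "\<And>i. d i > 0" "\<And>i y. dist y (z $ i) < d i \<Longrightarrow> y \<in> A i"
    by metis
  show ?thesis
  proof (rule that)
    show "Min (range d) > 0"
      using d(1) by (subst Min_gr_iff) auto
    show "coord_box z (Min (range d)) \<subseteq> U"
    proof
      fix w assume "w \<in> coord_box z (Min (range d))"
      then have "dist (w $ i) (z $ i) < d i" for i
        unfolding coord_box_def by (auto simp: Min_gr_iff)
      then show "w \<in> U" using d(2) sub by blast
    qed
  qed
qed

lemma replace_left_coord_box:
  fixes z :: "'k::metric_space ^ ('n::finite + 'p::finite)"
  assumes "e > 0" "left_coords w \<in> left_coords ` coord_box z e"
  shows "replace_left z (left_coords w) \<in> coord_box z e"
  unfolding coord_box_def
proof (intro CollectI allI)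
  fix i :: "'n + 'p"
  show "dist (replace_left z (left_coords w) $ i) (z $ i) < e"
    using assms by (cases i) (auto simp: coord_box_def vec_eq_iff)
qed

text \<open>A point of the projected box lifts by taking the right coordinates of the centre
  \<open>z\<close>, which are at distance 0 from themselves; this is where \<open>e > 0\<close>
  enters.\<close>

lemma left_coords_coord_box:
  assumes "e > 0"
  shows "left_coords ` coord_box z e = coord_box (left_coords z) e"
proof (intro equalityI subsetI)
  fix x assume "x \<in> left_coords ` coord_box z e"
  then show "x \<in> coord_box (left_coords z) e" by (auto simp: coord_box_def)
next
  fix x assume "x \<in> coord_box (left_coords z) e"
  then have "replace_left z x \<in> coord_box z e"
    using assms unfolding coord_box_def
    by (auto simp: replace_left_def split: sum.split)
  then show "x \<in> left_coords ` coord_box z e"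
    by (metis image_eqI left_coords_replace_left)
qed

lemma continuous_on_left_coords:
  "continuous_on S (left_coords :: 'k::topological_space ^ ('n::finite + 'p::finite) \<Rightarrow> _)"
  unfolding left_coords_def by (intro continuous_intros)

text \<open>Cylinders are the domains of the transported functions. The right block of
  \<open>w\<close> may differ from that of \<open>z\<close>, as it must when \<tt> is exchanged for
  \<tt>'.\<close>

lemma open_cylinder:
  assumes "e > 0"
  shows "open {w. left_coords w \<in> left_coords ` coord_box z e}"
  unfolding left_coords_coord_box[OF assms]
  using open_vimage[OF open_coord_box continuous_on_left_coords]
  by (simp add: vimage_def)

section \<open>Continuity and derivative of the substitution\<close>

lemma continuous_on_replace_left:
  fixes z :: "'k::topological_space ^ ('n::finite + 'p::finite)"
  shows "continuous_on S (\<lambda>w :: 'k ^ ('n + 'q::finite). replace_left z (left_coords w))"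
  unfolding replace_left_def
proof (rule continuous_on_vec_lambda)
  fix i :: "'n + 'p"
  show "continuous_on S (\<lambda>w :: 'k ^ ('n + 'q).
      case i of Inl a \<Rightarrow> left_coords w $ a | Inr b \<Rightarrow> z $ Inr b)"
    by (cases i) (auto intro!: continuous_intros)
qed

lemma bounded_linear_replace_left_zero:
  "bounded_linear (\<lambda>w :: 'k::real_normed_field ^ ('n::finite + 'q::finite).
     replace_left (0 :: 'k ^ ('n + 'p::finite)) (left_coords w))"
proof (rule bounded_linear_intro)
  fix w :: "'k ^ ('n + 'q)"
  have "norm (replace_left (0 :: 'k ^ ('n + 'p)) (left_coords w)) \<le>
      (\<Sum>i\<in>UNIV. norm (replace_left (0 :: 'k ^ ('n + 'p)) (left_coords w) $ i))"
    unfolding norm_vec_def by (rule L2_set_le_sum) simp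
  also have "\<dots> \<le> of_nat CARD('n + 'p) * norm w"
  proof (rule sum_bounded_above)
    fix i :: "'n + 'p"
    show "norm (replace_left (0 :: 'k ^ ('n + 'p)) (left_coords w) $ i) \<le> norm w"
      by (cases i) (auto simp: Finite_Cartesian_Product.norm_nth_le)
  qed
  finally show "norm (replace_left (0 :: 'k ^ ('n + 'p)) (left_coords w)) \<le>
      norm w * of_nat CARD('n + 'p)"
    by (simp add: mult.commute)
qed (auto simp: vec_sum_eq_iff)

lemma has_derivative_replace_left:
  fixes z :: "'k::real_normed_field ^ ('n::finite + 'p::finite)"
  shows "((\<lambda>w :: 'k ^ ('n + 'q::finite). replace_left z (left_coords w)) has_derivative
     (\<lambda>v. replace_left 0 (left_coords v))) (at w)"
proof -
  \<comment> \<open>The substitution is affine: a constant carrying the right coordinates of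
    \<open>z\<close>, plus the bounded linear map of the previous lemma.\<close>
  have eq: "(\<lambda>w :: 'k ^ ('n + 'q). replace_left z (left_coords w)) =
      (\<lambda>w. replace_left z 0 + replace_left 0 (left_coords w))"
    by (auto simp: vec_sum_eq_iff fun_eq_iff)
  show ?thesis
    unfolding eq
    by (rule derivative_eq_intros bounded_linear_imp_has_derivative
          bounded_linear_replace_left_zero refl)+ simp
qed

section \<open>Differentiability\<close>

lemma pderiv_at_replace_left_Inl:
  "pderiv_at (Inl a) (\<lambda>w. F (replace_left z (left_coords w))) =
   (\<lambda>w. pderiv_at (Inl a) F (replace_left z (left_coords w)))"
  by (simp add: pderiv_at_def fun_eq_iff replace_left_add_axis_Inl)

lemma pderiv_at_replace_left_Inr:
  "pderiv_at (Inr b) (\<lambda>w. F (replace_left z (left_coords w))) = (\<lambda>w. 0)"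
  by (simp add: pderiv_at_def fun_eq_iff replace_left_add_axis_Inr)

lemma pderiv_at_zero: "pderiv_at j (\<lambda>w. 0) = (\<lambda>w. 0)"
  by (simp add: pderiv_at_def fun_eq_iff)

text \<open>A left derivative commutes with the substitution, while a right derivative turns the
  composite into the zero function, which stays zero. Hence only two shapes occur, and smoothness of
  the composite reduces to that of \<open>F\<close>.\<close>

lemma iterated_pderiv_at_replace_left:
  fixes z :: "'k::real_normed_field ^ ('n::finite + 'p::finite)"
    and js :: "('n + 'q::finite) list"
  shows "foldr pderiv_at js (\<lambda>w. F (replace_left z (left_coords w))) = (\<lambda>w. 0) \<or>
     (\<exists>is. foldr pderiv_at js (\<lambda>w. F (replace_left z (left_coords w))) =
        (\<lambda>w. foldr pderiv_at is F (replace_left z (left_coords w))))"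
proof (induction js)
  case Nil
  show ?case by (auto intro!: exI[of _ "[]"])
next
  case (Cons j js)
  then consider
      "foldr pderiv_at js (\<lambda>w. F (replace_left z (left_coords w))) = (\<lambda>w. 0)"
    | "is" where "foldr pderiv_at js (\<lambda>w. F (replace_left z (left_coords w))) =
        (\<lambda>w. foldr pderiv_at is F (replace_left z (left_coords w)))"
    by blast
  then show ?case
  proof cases
    case 1
    then show ?thesis by (simp add: pderiv_at_zero)
  next
    case 2
    show ?thesis
    proof (cases j)
      case (Inl a)
      with 2 show ?thesis
        by (intro disjI2 exI[of _ "Inl a # is"]) (simp add: pderiv_at_replace_left_Inl)
    next
      case (Inr b)
      with 2 show ?thesis by (simp add: pderiv_at_replace_left_Inr)
    qed
  qed
qed

lemma smooth_on_replace_left: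
  fixes z :: "'k::real_normed_field ^ ('n::finite + 'p::finite)"
    and W :: "('k ^ ('n + 'q::finite)) set"
  assumes F: "smooth_on U F"
    and W: "\<And>w. w \<in> W \<Longrightarrow> replace_left z (left_coords w) \<in> U"
  shows "smooth_on W (\<lambda>w. F (replace_left z (left_coords w)))"
  unfolding smooth_on_def
proof (intro allI)
  fix js :: "('n + 'q) list"
  let ?G = "\<lambda>w :: 'k ^ ('n + 'q). F (replace_left z (left_coords w))"
  from iterated_pderiv_at_replace_left[of js F z]
  consider "foldr pderiv_at js ?G = (\<lambda>w. 0)"
    | "is" where "foldr pderiv_at js ?G =
        (\<lambda>w. foldr pderiv_at is F (replace_left z (left_coords w)))"
    by blast
  then show "continuous_on W (foldr pderiv_at js ?G) \<and>
      (\<forall>w\<in>W. \<forall>j. (\<lambda>t. foldr pderiv_at js ?G (w + axis j t)) field_differentiable at 0)"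
  proof cases
    case 1
    then show ?thesis by simp
  next
    case 2
    have "continuous_on U (foldr pderiv_at is F)"
      using F by (auto simp: smooth_on_def)
    then have "continuous_on W (\<lambda>w. foldr pderiv_at is F (replace_left z (left_coords w)))"
      by (rule continuous_on_compose2[OF _ continuous_on_replace_left]) (use W in auto)
    moreover have "(\<lambda>t. foldr pderiv_at is F (replace_left z (left_coords (w + axis j t))))
        field_differentiable at 0" if "w \<in> W" for w j
    proof (cases j)
      case (Inl a)
      have "(\<lambda>t. foldr pderiv_at is F (replace_left z (left_coords w) + axis (Inl a) t))
          field_differentiable at 0"
        using F W[OF that] by (auto simp: smooth_on_def)
      then show ?thesis by (simp only: Inl replace_left_add_axis_Inl)
    next
      case (Inr b)
      show ?thesis by (simp add: Inr replace_left_add_axis_Inr)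
    qed
    ultimately show ?thesis by (simp only: 2) blast
  qed
qed

lemma holomorphic_fun_on_replace_left:
  fixes z :: "'k::real_normed_field ^ ('n::finite + 'p::finite)"
    and W :: "('k ^ ('n + 'q::finite)) set"
  assumes F: "holomorphic_fun_on U F"
    and W: "\<And>w. w \<in> W \<Longrightarrow> replace_left z (left_coords w) \<in> U"
  shows "holomorphic_fun_on W (\<lambda>w. F (replace_left z (left_coords w)))"
  unfolding holomorphic_fun_on_def
proof
  fix w assume "w \<in> W"
  then obtain D where D: "(F has_derivative D) (at (replace_left z (left_coords w)))"
      and lin: "\<And>c v. D (c *s v) = c * D v"
    using F W unfolding holomorphic_fun_on_def by blast
  \<comment> \<open>The linear part of the substitution is linear over the ground field, so the
    derivative of the composite remains so.\<close>
  have scale: "replace_left 0 (left_coords (c *s v)) =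
      c *s (replace_left 0 (left_coords v) :: 'k ^ ('n + 'p))"
    for c and v :: "'k ^ ('n + 'q)"
    by (simp add: vec_sum_eq_iff)
  have "((\<lambda>w :: 'k ^ ('n + 'q). F (replace_left z (left_coords w))) has_derivative
      (\<lambda>v. D (replace_left 0 (left_coords v)))) (at w)"
    by (rule has_derivative_compose[OF has_derivative_replace_left D])
  then show "\<exists>D'. ((\<lambda>w :: 'k ^ ('n + 'q). F (replace_left z (left_coords w)))
      has_derivative D') (at w) \<and> (\<forall>c v. D' (c *s v) = c * D' v)"
    by (intro exI conjI) (auto simp: scale lin)
qed

lemma differentiable_fun_on_replace_left:
  assumes "differentiable_fun_on U F"
    and "\<And>w. w \<in> W \<Longrightarrow> replace_left z (left_coords w) \<in> U"
  shows "differentiable_fun_on W (\<lambda>w. F (replace_left z (left_coords w)))"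
  using assms smooth_on_replace_left holomorphic_fun_on_replace_left
  unfolding differentiable_fun_on_def by metis

text \<open>Over the reals this is the case of the empty list of derivatives in
  \<open>smooth_on\<close>. Otherwise the chain rule along the line through \<open>z\<close> gives
  \<open>D (axis j t)\<close>, and linearity of \<open>D\<close> over the ground field makes this
  multiplication by \<open>D (axis j 1)\<close>, as a field derivative requires.\<close>

lemma differentiable_fun_on_imp_field_differentiable:
  fixes F :: "'k::real_or_complex ^ 'm::finite \<Rightarrow> 'k"
  assumes F: "differentiable_fun_on U F" and "z \<in> U"
  shows "(\<lambda>t. F (z + axis j t)) field_differentiable (at 0)"
proof (cases "(UNIV :: 'k set) = \<real>")
  case True
  then have "smooth_on U F"
    using F by (simp add: differentiable_fun_on_def)
  then have "(\<lambda>t. foldr pderiv_at [] F (z + axis j t)) field_differentiable (at 0)"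
    using \<open>z \<in> U\<close> unfolding smooth_on_def by blast
  then show ?thesis by simp
next
  case False
  then have "holomorphic_fun_on U F"
    using F by (simp add: differentiable_fun_on_def)
  then obtain D where D: "(F has_derivative D) (at z)" and lin: "\<And>c v. D (c *s v) = c * D v"
    using \<open>z \<in> U\<close> unfolding holomorphic_fun_on_def by blast
  have axis: "axis j t = t *s (axis j 1 :: 'k ^ 'm)" for t
    by (auto simp: vec_eq_iff axis_def)
  have "bounded_linear (\<lambda>t :: 'k. axis j t :: 'k ^ 'm)"
    by (rule bounded_linear_intro[where K = 1])
      (auto simp: vec_eq_iff axis_def norm_vec_def L2_set_def if_distrib[of norm]
        if_distrib[of "\<lambda>x. x\<^sup>2"] cong: if_cong)
  then have "((\<lambda>t :: 'k. z + axis j t) has_derivative (\<lambda>t. axis j t)) (at 0)"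
    by (auto intro!: derivative_eq_intros bounded_linear_imp_has_derivative)
  moreover have "(F has_derivative D) (at (z + axis j 0))"
    using D by (simp add: axis_def zero_vec_def[symmetric])
  ultimately have "((\<lambda>t. F (z + axis j t)) has_derivative (\<lambda>t. D (axis j t))) (at 0)"
    by (rule has_derivative_compose)
  moreover have "(\<lambda>t. D (axis j t)) = (*) (D (axis j 1))"
    by (subst axis) (auto simp: lin mult.commute)
  ultimately show ?thesis
    unfolding field_differentiable_def has_field_derivative_def by auto
qed

section \<open>Vanishing right derivatives leave a function of the left coordinates\<close>

lemma constant_along_axis:
  fixes F :: "'k::real_or_complex ^ 'm::finite \<Rightarrow> 'k"
  assumes F: "differentiable_fun_on U F" and box: "coord_box z e \<subseteq> U"
    and zero: "\<And>w. w \<in> U \<Longrightarrow> pderiv_at j F w = 0"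
    and v: "v \<in> coord_box z e" and w: "w \<in> coord_box z e"
    and eq: "\<And>i. i \<noteq> j \<Longrightarrow> v $ i = w $ i"
  shows "F v = F w"
proof -
  \<comment> \<open>The line is parametrised by the value of its \<open>j\<close>-th coordinate, so
    that \<open>g (v $ j)\<close> is \<open>F v\<close> and \<open>g (w $ j)\<close> is
    \<open>F w\<close>. Both parameters lie in a ball, which is convex, and there \<open>g\<close>
    has derivative zero.\<close>
  define g where "g t = F (v + axis j (t - v $ j))" for t
  have "(g has_field_derivative 0) (at t)" if t: "t \<in> ball (z $ j) e" for t
  proof -
    let ?u = "v + axis j (t - v $ j)"
    have "?u \<in> coord_box z e"
      unfolding coord_box_def
    proof (intro CollectI allI)
      fix i
      show "dist (?u $ i) (z $ i) < e"
        using t v by (cases "i = j") (auto simp: coord_box_def axis_def dist_commute)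
    qed
    then have u: "?u \<in> U" using box by blast
    \<comment> \<open>A zero value of \<open>deriv\<close> amounts to a zero derivative only for a
      differentiable function; differentiability of \<open>F\<close> along the axis is therefore
      used here.\<close>
    have "((\<lambda>s. F (?u + axis j s)) has_field_derivative 0) (at 0)"
      using differentiable_fun_on_imp_field_differentiable[OF F u, of j] zero[OF u]
      by (simp add: pderiv_at_def flip: DERIV_deriv_iff_field_differentiable)
    moreover have "(\<lambda>s. F (?u + axis j s)) = (\<lambda>s. g (s + t))"
      unfolding g_def
      by (intro ext arg_cong[where f = F]) (auto simp: vec_eq_iff axis_def)
    ultimately show ?thesis
      using DERIV_shift[of g 0 0 t] by simp
  qed
  then have "\<exists>c. \<forall>t\<in>ball (z $ j) e. g t = c"
    by (intro has_field_derivative_zero_constant[OF convex_ball])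
      (rule has_field_derivative_at_within)
  moreover have "v $ j \<in> ball (z $ j) e" "w $ j \<in> ball (z $ j) e"
    using v w by (auto simp: coord_box_def dist_commute)
  ultimately have "g (v $ j) = g (w $ j)" by metis
  moreover have "v + axis j (w $ j - v $ j) = w"
    using eq by (auto simp: vec_eq_iff axis_def)
  moreover have "v + axis j (v $ j - v $ j) = v"
    by (auto simp: vec_eq_iff axis_def)
  ultimately show ?thesis by (simp only: g_def)
qed

lemma depends_on_left_coords:
  fixes F :: "'k::real_or_complex ^ ('n::finite + 'p::finite) \<Rightarrow> 'k"
  assumes F: "differentiable_fun_on U F" and box: "coord_box z e \<subseteq> U" and "e > 0"
    and zero: "\<And>w b. w \<in> U \<Longrightarrow> pderiv_at (Inr b) F w = 0"
    and w: "w \<in> coord_box z e"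
  shows "F w = F (replace_left z (left_coords w))"
proof -
  \<comment> \<open>A path from \<open>w\<close> to its projection: the right coordinates in
    \<open>S\<close> are already those of the centre. Adding one index to \<open>S\<close> changes
    one coordinate and stays in the box, so induction on \<open>S\<close> applies.\<close>
  define h where "h S = (\<chi> i. case i of Inl a \<Rightarrow> w $ Inl a
      | Inr b \<Rightarrow> if b \<in> S then z $ Inr b else w $ Inr b)" for S
  have h_box: "h S \<in> coord_box z e" for S
    using w \<open>e > 0\<close> by (auto simp: coord_box_def h_def split: sum.split)
  have "F (h S) = F w" if "finite S" for S
    using that
  proof (induction S)
    case empty
    have "h {} = w" by (simp add: h_def vec_sum_eq_iff)
    then show ?case by simp
  next
    case (insert b S)
    have "F (h (insert b S)) = F (h S)"
    proof (rule constant_along_axis[OF F box, where j = "Inr b"])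
      show "h (insert b S) $ i = h S $ i" if "i \<noteq> Inr b" for i
        using that by (cases i) (auto simp: h_def)
    qed (use zero h_box in auto)
    then show ?case using insert by simp
  qed
  moreover have "h UNIV = replace_left z (left_coords w)"
    by (simp add: h_def vec_sum_eq_iff)
  ultimately show ?thesis by (metis finite)
qed

section \<open>Functional independence\<close>

lemma pderiv_at_cong_open:
  fixes F G :: "'k::real_normed_field ^ 'm::finite \<Rightarrow> 'k"
  assumes "open B" "w \<in> B" and eq: "\<And>v. v \<in> B \<Longrightarrow> F v = G v"
  shows "pderiv_at j F w = pderiv_at j G w"
proof -
  obtain e where "e > 0" and e: "coord_box w e \<subseteq> B"
    using coord_box_subset[OF assms(1,2)] .
  have "\<forall>\<^sub>F t in nhds 0. F (w + axis j t) = G (w + axis j t)"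
    unfolding eventually_nhds_metric
  proof (intro exI conjI allI impI)
    fix t :: 'k assume "dist t 0 < e"
    then have "w + axis j t \<in> coord_box w e"
      using \<open>e > 0\<close> by (auto simp: coord_box_def axis_def dist_norm)
    then show "F (w + axis j t) = G (w + axis j t)"
      using e eq by blast
  qed fact
  then show ?thesis
    unfolding pderiv_at_def by (rule deriv_cong_ev) simp
qed

text \<open>The Jacobian of the composites has zero right columns, and its left columns are those of
  the original functions at any point of the box with the same left coordinates. Full rank thus
  transfers pointwise, and density follows by continuity of the substitution.\<close>

lemma functionally_independent_on_cylinder:
  fixes F :: "nat \<Rightarrow> 'k::real_or_complex ^ ('n::finite + 'p::finite) \<Rightarrow> 'k"
  assumes indep: "functionally_independent_on U q F"
    and box: "coord_box z e \<subseteq> U" and "e > 0"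
    and diff: "\<And>i. i < q \<Longrightarrow> differentiable_fun_on U (F i)"
    and zero: "\<And>i w b. i < q \<Longrightarrow> w \<in> U \<Longrightarrow> pderiv_at (Inr b) (F i) w = 0"
  shows "functionally_independent_on
    {w :: 'k ^ ('n + 'q::finite). left_coords w \<in> left_coords ` coord_box z e}
    q (\<lambda>i w. F i (replace_left z (left_coords w)))"
proof -
  let ?B = "coord_box z e"
  let ?W = "{w :: 'k ^ ('n + 'q). left_coords w \<in> left_coords ` ?B}"
  let ?G = "\<lambda>i (w :: 'k ^ ('n + 'q)). F i (replace_left z (left_coords w))"
  let ?A = "{u \<in> U. \<forall>c. (\<forall>j. (\<Sum>i<q. c i * pderiv_at j (F i) u) = 0) \<longrightarrow> (\<forall>i<q. c i = 0)}"
  let ?A' = "{w \<in> ?W. \<forall>c. (\<forall>j. (\<Sum>i<q. c i * pderiv_at j (?G i) w) = 0) \<longrightarrow> (\<forall>i<q. c i = 0)}"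
  \<comment> \<open>Each \<open>F i\<close> agrees on the open box with its composite, and left
    derivatives commute with the substitution.\<close>
  have grad: "pderiv_at (Inl a) (F i) u = pderiv_at (Inl a) (F i) (replace_left z (left_coords u))"
    if "i < q" "u \<in> ?B" for i u a
  proof -
    have "pderiv_at (Inl a) (F i) u =
        pderiv_at (Inl a) (\<lambda>v. F i (replace_left z (left_coords v))) u"
      using that(2)
      by (rule pderiv_at_cong_open[OF open_coord_box])
        (rule depends_on_left_coords[OF diff[OF that(1)] box \<open>e > 0\<close> zero[OF that(1)]])
    then show ?thesis by (simp add: pderiv_at_replace_left_Inl)
  qed
  \<comment> \<open>A linear relation between the gradients of the composites at the new point is
    one between the gradients of the \<open>F i\<close> at \<open>u\<close>: left entries agree by
    \<open>grad\<close>, right entries vanish.\<close>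
  have image: "replace_left w (left_coords u) \<in> ?A'" if u: "u \<in> ?B \<inter> ?A" for w u
  proof -
    have "\<forall>i<q. c i = 0"
      if c: "\<forall>j. (\<Sum>i<q. c i * pderiv_at j (?G i) (replace_left w (left_coords u))) = 0" for c
    proof -
      have "(\<Sum>i<q. c i * pderiv_at j (F i) u) = 0" for j
      proof (cases j)
        case (Inl a)
        have "(\<Sum>i<q. c i * pderiv_at j (F i) u) =
            (\<Sum>i<q. c i * pderiv_at (Inl a) (?G i) (replace_left w (left_coords u)))"
          using grad u Inl by (intro sum.cong) (auto simp: pderiv_at_replace_left_Inl)
        with c show ?thesis by simp
      next
        case (Inr b)
        then show ?thesis using zero u by simp
      qed
      then show ?thesis using u by blast
    qed
    then show ?thesis using u by auto
  qed
  have "?W \<subseteq> closure ?A'"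
  proof
    fix w assume w: "w \<in> ?W"
    \<comment> \<open>The right coordinates are now frozen at those of the target \<open>w\<close>,
      so that the projection of \<open>w\<close> into the box is sent exactly to
      \<open>w\<close>.\<close>
    let ?f = "\<lambda>u :: 'k ^ ('n + 'p). replace_left w (left_coords u)"
    have "replace_left z (left_coords w) \<in> ?B"
      using w \<open>e > 0\<close> by (simp add: replace_left_coord_box)
    then have "replace_left z (left_coords w) \<in> ?B \<inter> closure ?A"
      using box indep unfolding functionally_independent_on_def by blast
    \<comment> \<open>Since the box is open, the approximating points of full rank may be chosen
      inside it, where \<open>image\<close> applies.\<close>
    then have "replace_left z (left_coords w) \<in> closure (?B \<inter> ?A)"
      using open_Int_closure_subset[OF open_coord_box] by blast
    moreover have "?f ` closure (?B \<inter> ?A) \<subseteq> closure ?A'"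
    proof (rule image_closure_subset[OF continuous_on_replace_left closed_closure])
      show "?f ` (?B \<inter> ?A) \<subseteq> closure ?A'"
        by (rule subset_trans[OF image_subsetI closure_subset]) (rule image)
    qed
    ultimately have "?f (replace_left z (left_coords w)) \<in> closure ?A'"
      by (rule subsetD[OF _ imageI, rotated])
    moreover have "?f (replace_left z (left_coords w)) = w"
      by (simp add: vec_sum_eq_iff)
    ultimately show "w \<in> closure ?A'" by simp
  qed
  then show ?thesis unfolding functionally_independent_on_def .
qed

text \<open>The dense set of full rank is nonempty because \<open>U\<close> is. At one of its points
  the \<open>q\<close> gradients are linearly independent vectors in a space of dimension
  \<open>CARD('m)\<close>.\<close>

lemma functionally_independent_on_le_CARD:
  fixes F :: "nat \<Rightarrow> 'k::real_normed_field ^ 'm::finite \<Rightarrow> 'k"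
  assumes "functionally_independent_on U q F" "U \<noteq> {}"
  shows "q \<le> CARD('m)"
proof -
  have "{z \<in> U. \<forall>c. (\<forall>j. (\<Sum>i<q. c i * pderiv_at j (F i) z) = 0) \<longrightarrow> (\<forall>i<q. c i = 0)} \<noteq> {}"
    using assms unfolding functionally_independent_on_def
    by (metis (no_types, lifting) closure_empty subset_empty)
  then obtain z where z:
      "\<And>c. (\<forall>j. (\<Sum>i<q. c i * pderiv_at j (F i) z) = 0) \<Longrightarrow> (\<forall>i<q. c i = 0)"
    by blast
  define g where "g i = (\<chi> j. pderiv_at j (F i) z)" for i
  have g: "\<forall>i<q. c i = 0" if "(\<Sum>i<q. c i *s g i) = 0" for c
  proof (rule z, rule allI)
    fix j
    have "(\<Sum>i<q. c i *s g i) $ j = 0" using that by simp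
    then show "(\<Sum>i<q. c i * pderiv_at j (F i) z) = 0" by (simp add: g_def)
  qed
  \<comment> \<open>Independence of a set ignores repetitions, so equal gradients must be excluded
    separately: they would give a relation with coefficients 1 and - 1.\<close>
  have inj: "inj_on g {..<q}"
  proof (rule inj_onI, rule ccontr)
    fix i i' assume i: "i \<in> {..<q}" "i' \<in> {..<q}" "g i = g i'" "i \<noteq> i'"
    let ?c = "\<lambda>l. if l = i then 1 else if l = i' then - 1 else 0 :: 'k"
    have "(\<Sum>l<q. ?c l *s g l) = (\<Sum>l\<in>{i, i'}. ?c l *s g l)"
      using i by (intro sum.mono_neutral_right) auto
    also have "\<dots> = 0" using i by simp
    finally show False using g[of ?c] i by fastforce
  qed
  have "vec.independent (g ` {..<q})"
  proof (rule vec.independent_if_scalars_zero)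
    fix f x assume "(\<Sum>x\<in>g ` {..<q}. f x *s x) = 0" "x \<in> g ` {..<q}"
    then show "f x = 0" using g[of "f \<circ> g"] by (auto simp: sum.reindex[OF inj])
  qed simp
  then have "card (g ` {..<q}) \<le> vec.dim (UNIV :: ('k ^ 'm) set)"
    by (rule vec.independent_card_le_dim[OF subset_UNIV])
  then show ?thesis unfolding vec_dim_card by (simp add: card_image[OF inj])
qed

section \<open>Coadjoint fields\<close>

lemma range_case_sum: "range (case_sum X Y) = range X \<union> range Y"
  by (simp add: UNIV_sum image_Un image_image)

context lie_algebra
begin

text \<open>A bracket with \<open>X a\<close> stays in the span of the \<open>X\<close>, so its
  expansion in the full basis is its expansion in the \<open>X\<close> alone. Disjointness ensures
  that no \<open>Y b\<close> is among these vectors.\<close>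

lemma structure_constant_case_sum:
  assumes indep: "independent (range (case_sum X Y))" and Y: "range X \<inter> range Y = {}"
    and ideal: "\<And>y a. bracket y (X a) \<in> span (range X)"
  shows "structure_constant (case_sum X Y) i (Inl a) (Inl c) =
      representation (range X) (bracket (case_sum X Y i) (X a)) (X c)"
    and "structure_constant (case_sum X Y) i (Inl a) (Inr b) = 0"
proof -
  have "range X \<subseteq> range (case_sum X Y)"
    by (simp add: range_case_sum)
  then have eq: "representation (range (case_sum X Y)) (bracket y (X a)) =
      representation (range X) (bracket y (X a))" for y
    by (rule representation_extend[OF indep ideal])
  show "structure_constant (case_sum X Y) i (Inl a) (Inl c) =
      representation (range X) (bracket (case_sum X Y i) (X a)) (X c)"
    by (simp add: structure_constant_def eq)
  have "Y b \<notin> range X" using Y by blast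
  then show "structure_constant (case_sum X Y) i (Inl a) (Inr b) = 0"
    using representation_ne_zero by (auto simp: structure_constant_def eq)
qed

text \<open>Up to sign, the coadjoint field of an arbitrary element \<open>y\<close>, applied to a
  function of the left coordinates with gradient \<open>D\<close>. Allowing any \<open>y\<close>,
  not only basis vectors, makes linearity in \<open>y\<close> available and removes the dependence
  on the complement.\<close>

definition left_field :: "('n::finite \<Rightarrow> 'a) \<Rightarrow> 'a \<Rightarrow> 'k ^ 'n \<Rightarrow> ('n \<Rightarrow> 'k) \<Rightarrow> 'k" where
  "left_field X y x D = (\<Sum>a\<in>UNIV. \<Sum>c\<in>UNIV.
     representation (range X) (bracket y (X a)) (X c) * x $ c * D a)"

text \<open>Terms with a right derivative vanish by assumption; in the others the structure
  constants vanish for right \<open>k\<close>, so only left coordinates of \<open>z\<close>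
  remain.\<close>

lemma coadjoint_field_case_sum:
  fixes X :: "'n::finite \<Rightarrow> 'a" and Y :: "'q::finite \<Rightarrow> 'a"
  assumes "independent (range (case_sum X Y))" "range X \<inter> range Y = {}"
    and "\<And>y a. bracket y (X a) \<in> span (range X)"
    and zero: "\<And>b. pderiv_at (Inr b) F z = 0"
  shows "coadjoint_field (case_sum X Y) i F z =
    - left_field X (case_sum X Y i) (left_coords z) (\<lambda>a. pderiv_at (Inl a) F z)"
proof -
  have split: "(\<Sum>j\<in>UNIV. f j) = (\<Sum>a\<in>UNIV. f (Inl a)) + (\<Sum>b\<in>UNIV. f (Inr b))"
    for f :: "'n + 'q \<Rightarrow> 'k"
    using sum.Plus[of "UNIV :: 'n set" "UNIV :: 'q set" f] by (simp add: comp_def)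
  show ?thesis
    by (simp add: coadjoint_field_def left_field_def split zero
        structure_constant_case_sum[OF assms(1-3)])
qed

text \<open>The bracket is linear in its first argument and coefficients in a basis are linear, so
  \<open>left_field\<close> is linear in \<open>y\<close> and vanishes on a span as soon as it does
  on the generators.\<close>

lemma left_field_eq_0:
  assumes indep: "independent (range X)"
    and ideal: "\<And>y a. bracket y (X a) \<in> span (range X)"
    and gen: "\<And>s. s \<in> S \<Longrightarrow> left_field X s x D = 0" and y: "y \<in> span S"
  shows "left_field X y x D = 0"
  using y
proof (induction rule: span_induct_alt)
  case base
  have "bracket 0 v = 0" for v
    using linear_left[of v] unfolding linear_iff_module_hom by (rule module_hom.zero)
  then show ?case by (simp add: left_field_def representation_zero)
next
  case (step c u v)
  have hom: "module_hom scale scale (\<lambda>x. bracket x w)" for w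
    using linear_left[of w] unfolding linear_iff_module_hom .
  have "bracket (scale c u + v) w = scale c (bracket u w) + bracket v w" for w
    using module_hom.add[OF hom] module_hom.scale[OF hom] by simp
  then have "representation (range X) (bracket (scale c u + v) (X a)) b =
      c * representation (range X) (bracket u (X a)) b + representation (range X) (bracket v (X a)) b"
    for a b
    by (simp add: representation_add[OF indep ideal span_scale[OF ideal]]
        representation_scale[OF indep ideal])
  then have "left_field X (scale c u + v) x D = c * left_field X u x D + left_field X v x D"
    by (simp add: left_field_def sum.distrib sum_distrib_left distrib_right mult.assoc)
  then show ?case using step gen by simp
qed

text \<open>Invariance under a basis of the whole algebra makes \<open>left_field\<close> vanish for
  every element, in particular for each \<open>Y' b\<close>, which belongs to a different basis
  family.\<close>

lemma invariant_on_cylinder: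
  fixes X :: "'n::finite \<Rightarrow> 'a" and Y :: "'p::finite \<Rightarrow> 'a" and Y' :: "'q::finite \<Rightarrow> 'a"
  assumes Y: "independent (range (case_sum X Y))" "range X \<inter> range Y = {}"
    and Y': "independent (range (case_sum X Y'))" "range X \<inter> range Y' = {}"
    and ideal: "\<And>y a. bracket y (X a) \<in> span (range X)"
    and span: "span (range (case_sum X Y)) = UNIV"
    and F: "invariant_on (case_sum X Y) U F"
    and zero: "\<And>w b. w \<in> U \<Longrightarrow> pderiv_at (Inr b) F w = 0"
    and box: "coord_box z e \<subseteq> U" and "e > 0"
  shows "invariant_on (case_sum X Y') {w. left_coords w \<in> left_coords ` coord_box z e}
    (\<lambda>w. F (replace_left z (left_coords w)))"
proof -
  let ?W = "{w :: 'k ^ ('n + 'q). left_coords w \<in> left_coords ` coord_box z e}"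
  let ?G = "\<lambda>w :: 'k ^ ('n + 'q). F (replace_left z (left_coords w))"
  have U: "replace_left z (left_coords w) \<in> U" if "w \<in> ?W" for w
    using that box \<open>e > 0\<close> replace_left_coord_box by blast
  \<comment> \<open>The cylinder is nonempty: the left coordinates of the centre are completed by
    zeros.\<close>
  have "left_coords (replace_left 0 (left_coords z) :: 'k ^ ('n + 'q)) \<in>
      left_coords ` coord_box z e"
    using centre_in_coord_box[OF \<open>e > 0\<close>, of z] by simp
  then have "?W \<noteq> {}" by blast
  moreover have "differentiable_fun_on ?W ?G"
    using F U by (intro differentiable_fun_on_replace_left) (auto simp: invariant_on_def)
  moreover have "coadjoint_field (case_sum X Y') i ?G w = 0" if w: "w \<in> ?W" for w i
  proof -
    let ?u = "replace_left z (left_coords w)"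
    let ?D = "\<lambda>a. pderiv_at (Inl a) F ?u"
    \<comment> \<open>The point \<open>?u\<close> lies in \<open>U\<close> and has the left
      coordinates of \<open>w\<close>, so the equations for \<open>F\<close> at \<open>?u\<close>
      are those wanted for the composite at \<open>w\<close>.\<close>
    have gen: "left_field X s (left_coords w) ?D = 0" if s: "s \<in> range (case_sum X Y)" for s
    proof -
      from s obtain j where j: "s = case_sum X Y j" by blast
      have "coadjoint_field (case_sum X Y) j F ?u = 0"
        using F U[OF w] unfolding invariant_on_def by blast
      then show ?thesis
        using coadjoint_field_case_sum[OF Y ideal zero[OF U[OF w]], of j] by (simp add: j)
    qed
    have "y \<in> span (range (case_sum X Y))" for y
      using span by simp
    moreover have "independent (range X)"
      using Y(1) by (rule independent_mono) (simp add: range_case_sum)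
    ultimately have "left_field X y (left_coords w) ?D = 0" for y
      using left_field_eq_0[OF _ ideal gen] by blast
    then show ?thesis
      by (subst coadjoint_field_case_sum[OF Y' ideal])
        (simp_all add: pderiv_at_replace_left_Inl pderiv_at_replace_left_Inr)
  qed
  ultimately show ?thesis
    unfolding invariant_on_def using open_cylinder[OF \<open>e > 0\<close>] by blast
qed

section \<open>The number of independent invariants as an attained maximum\<close>

lemma finite_numbers_of_invariants:
  fixes Z :: "'m::finite \<Rightarrow> 'a"
  shows "finite {q. \<exists>U F. independent_invariants_on Z U q F}"
proof (rule finite_subset)
  show "{q. \<exists>U F. independent_invariants_on Z U q F} \<subseteq> {..CARD('m)}"
    using functionally_independent_on_le_CARD unfolding independent_invariants_on_def by fastforce
qed simp

lemma number_of_invariants_attained: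
  fixes Z :: "'m::finite \<Rightarrow> 'a"
  shows "\<exists>U F. independent_invariants_on Z U (number_of_invariants Z) F"
proof -
  \<comment> \<open>The empty family is always independent, so the set under \<open>Max\<close> is
    nonempty.\<close>
  have "independent_invariants_on Z UNIV 0 (\<lambda>_ _. 0)"
    by (auto simp: independent_invariants_on_def functionally_independent_on_def)
  then have "{q. \<exists>U F. independent_invariants_on Z U q F} \<noteq> {}" by blast
  from Max_in[OF finite_numbers_of_invariants this] show ?thesis
    by (simp add: number_of_invariants_def)
qed

lemma number_of_invariants_ge:
  "independent_invariants_on Z U q F \<Longrightarrow> q \<le> number_of_invariants Z"
  unfolding number_of_invariants_def by (rule Max_ge[OF finite_numbers_of_invariants]) blast

end

section \<open>Transfer from \<nn> \<oplus> \<tt> to \<nn> \<oplus> \<tt>'\<close>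

theorem proposition1:
  fixes scale :: "'k::real_or_complex \<Rightarrow> 'a::ab_group_add \<Rightarrow> 'a"
    and bracket :: "'a \<Rightarrow> 'a \<Rightarrow> 'a"
    and \<nn> \<tt> \<tt>' :: "'a set"
    and X :: "'n::finite \<Rightarrow> 'a" and V :: "'p::finite \<Rightarrow> 'a" and V' :: 'a
  assumes "lie_algebra scale bracket"
    and "lie_algebra.solvable scale bracket UNIV"
    and "\<not> lie_algebra.nilpotent scale bracket UNIV"
    and "lie_algebra.is_nilradical scale bracket \<nn>"
    and "lie_algebra.torus scale bracket \<tt>"
    and "lie_algebra.is_direct_sum scale UNIV \<nn> \<tt>"
    and "lie_algebra.is_basis scale (case_sum X V) UNIV"
    and "module.span scale (range X) = \<nn>"
    and "module.span scale (range V) = \<tt>"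
    and "\<forall>U F. lie_algebra.invariant_on scale bracket (case_sum X V) U F \<longrightarrow>
           (\<forall>z\<in>U. \<forall>i. pderiv_at (Inr i) F z = 0)"
    and "lie_algebra.subalgebra scale bracket \<tt>'" and "\<tt>' \<subseteq> \<tt>"
    and "vector_space.dim scale \<tt>' = 1"
    and "lie_algebra.bracket_span scale bracket \<tt>' (lie_algebra.center bracket \<nn>) \<noteq> {0}"
    and "module.span scale {V'} = \<tt>'"
  shows "(\<forall>U q F. lie_algebra.fundamental_invariants_on scale bracket (case_sum X V) U q F \<longrightarrow>
            (\<forall>i<q. \<forall>z\<in>U. \<exists>U\<^sub>0 f. open U\<^sub>0 \<and> z \<in> U\<^sub>0 \<and> U\<^sub>0 \<subseteq> U \<and>
               (\<forall>w\<in>U\<^sub>0. F i w = f (left_coords w)) \<and>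
               lie_algebra.invariant_on scale bracket (case_sum X (\<lambda>_::unit. V'))
                 {w. left_coords w \<in> left_coords ` U\<^sub>0} (\<lambda>w. f (left_coords w))))
         \<and> lie_algebra.number_of_invariants scale bracket (case_sum X (\<lambda>_::unit. V'))
             \<ge> lie_algebra.number_of_invariants scale bracket (case_sum X V)"
proof -
  interpret lie_algebra scale bracket by fact
  note nil = assms(4) and sum = assms(6) and basis = assms(7) and X = assms(8) and V = assms(9)
    and zero = assms(10) and sub = assms(12) and V' = assms(15)
  have ideal: "bracket y (X a) \<in> span (range X)" for y a
  proof -
    have "X a \<in> \<nn>" unfolding X[symmetric] by (rule span_base) simp
    then show ?thesis using nil unfolding X is_nilradical_def ideal_def by blast
  qed
  have indep: "independent (range (case_sum X V))" and inj: "inj (case_sum X V)"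
    and span: "span (range (case_sum X V)) = UNIV"
    using basis by (auto simp: is_basis_def)
  have disj: "range X \<inter> range V = {}"
  proof (rule ccontr)
    assume "range X \<inter> range V \<noteq> {}"
    then obtain a b where "case_sum X V (Inl a) = case_sum X V (Inr b)" by auto
    then show False using inj by (metis injD sum.distinct(1))
  qed
  \<comment> \<open>A zero generator would give \<tt>' dimension 0 instead of 1.\<close>
  have "V' \<noteq> 0"
  proof
    assume "V' = 0"
    then have "span {} = span \<tt>'" using V' by (auto simp: span_insert_0)
    then have "dim \<tt>' = card ({} :: 'a set)" by (intro dim_eq_card independent_empty) simp
    then show False using assms(13) by simp
  qed
  have "V' \<in> \<tt>" using V' sub span_base by blast
  \<comment> \<open>\<nn> and \<tt> meet only in 0, so a nonzero element of \<tt> lies outside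
    \<nn>; hence \<open>V'\<close> extends the basis of \<nn> to an independent family.\<close>
  with \<open>V' \<noteq> 0\<close> have V'_X: "V' \<notin> span (range X)"
    using sum unfolding X is_direct_sum_def by blast
  have disj': "range X \<inter> range (\<lambda>_::unit. V') = {}"
    using V'_X span_base by blast
  have "independent (range X)"
    using indep by (rule independent_mono) (simp add: range_case_sum)
  then have "independent (insert V' (range X))"
    using V'_X by (simp add: independent_insert)
  moreover have "range (case_sum X (\<lambda>_::unit. V')) = insert V' (range X)"
    by (auto simp: range_case_sum)
  ultimately have indep': "independent (range (case_sum X (\<lambda>_::unit. V')))" by simp
  note cylinder = invariant_on_cylinder[OF indep disj indep' disj' ideal span]
  show ?thesis
  proof (intro conjI allI impI ballI)
    fix U q F i z
    assume "fundamental_invariants_on (case_sum X V) U q F" "i < q" "z \<in> U"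
    then have F: "invariant_on (case_sum X V) U (F i)"
      by (simp add: fundamental_invariants_on_def independent_invariants_on_def)
    then have "open U" and diff: "differentiable_fun_on U (F i)"
      by (auto simp: invariant_on_def)
    have zero_F: "\<And>w b. w \<in> U \<Longrightarrow> pderiv_at (Inr b) (F i) w = 0"
      using zero F by blast
    obtain e where e: "e > 0" "coord_box z e \<subseteq> U"
      using coord_box_subset[OF \<open>open U\<close> \<open>z \<in> U\<close>] .
    \<comment> \<open>The local expression of the invariant in the coordinates on the dual of \<nn>,
      obtained by freezing the others at the chosen point \<open>z\<close>.\<close>
    let ?f = "\<lambda>x. F i (replace_left z x)"
    have "\<forall>w\<in>coord_box z e. F i w = ?f (left_coords w)"
      using depends_on_left_coords[OF diff e(2,1) zero_F] by blast
    with e show "\<exists>U\<^sub>0 f. open U\<^sub>0 \<and> z \<in> U\<^sub>0 \<and> U\<^sub>0 \<subseteq> U \<and> (\<forall>w\<in>U\<^sub>0. F i w = f (left_coords w)) \<and>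
        invariant_on (case_sum X (\<lambda>_::unit. V'))
          {w. left_coords w \<in> left_coords ` U\<^sub>0} (\<lambda>w. f (left_coords w))"
      using cylinder[OF F zero_F e(2,1)] open_coord_box centre_in_coord_box
      by (intro exI[of _ "coord_box z e"] exI[of _ ?f]) auto
  next
    let ?q = "number_of_invariants (case_sum X V)"
    \<comment> \<open>A family of maximal size for \<rr> is transported, with its independence, to a
      cylinder in the dual of \<nn> \<oplus> \<tt>', which bounds the maximum there from
      below.\<close>
    obtain U F where UF: "independent_invariants_on (case_sum X V) U ?q F"
      using number_of_invariants_attained by blast
    then obtain z where "z \<in> U" "open U" and F: "\<And>i. i < ?q \<Longrightarrow> invariant_on (case_sum X V) U (F i)"
      and fi: "functionally_independent_on U ?q F"
      unfolding independent_invariants_on_def by blast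
    obtain e where e: "e > 0" "coord_box z e \<subseteq> U"
      using coord_box_subset[OF \<open>open U\<close> \<open>z \<in> U\<close>] .
    have zero_F: "\<And>i w b. i < ?q \<Longrightarrow> w \<in> U \<Longrightarrow> pderiv_at (Inr b) (F i) w = 0"
      using zero F by blast
    have diff: "\<And>i. i < ?q \<Longrightarrow> differentiable_fun_on U (F i)"
      using F by (simp add: invariant_on_def)
    let ?W = "{w :: 'k ^ ('n + unit). left_coords w \<in> left_coords ` coord_box z e}"
    have "left_coords (replace_left 0 (left_coords z) :: 'k ^ ('n + unit)) \<in>
        left_coords ` coord_box z e"
      using centre_in_coord_box[OF e(1), of z] by simp
    then have "?W \<noteq> {}" by blast
    then have "independent_invariants_on (case_sum X (\<lambda>_::unit. V')) ?W ?q
        (\<lambda>i w. F i (replace_left z (left_coords w)))"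
      unfolding independent_invariants_on_def
      using open_cylinder[OF e(1)] cylinder[OF F zero_F e(2,1)]
        functionally_independent_on_cylinder[OF fi e(2,1) diff zero_F]
      by blast
    then show "?q \<le> number_of_invariants (case_sum X (\<lambda>_::unit. V'))"
      by (rule number_of_invariants_ge)
  qed
qed

end
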